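(* Let $(X,\mu)$ be a non-atomic Lebesgue space with a positive finite measure. If $T_1$ is a measure-preserving lightly mixing transformation on $(X,\mu)$ and $T_2$ is the rotation on two points, then $T_1\times T_2$ is measurably sensitive and ergodic but not weakly mixing.
   Context: The rotation on two points is the map $T_2$ of $\{1,2\}$ (with equal point masses) exchanging $1$ and $2$; $T_1\times T_2$ acts on $X\times\{1,2\}$ with the product measure. A system $(X,\mu,T)$ on a finite measure space is lightly mixing if $\liminf_{n\to\infty}\mu(T^{-n}(A)\cap B)>0$ for all sets $A$ and $B$ of positive measure. A transformation is weakly mixing if it is ergodic and its only $L^\infty$ eigenvalue is $1$, where $\lambda$ is an eigenvalue of $T$ if there is an a.e. nonzero $f\in L^\infty$ with $f\circ T=\lambda f$ a.e. A metric $d$ on a measure space is good if all nonempty open sets have positive measure; when a space carries a good metric, the measure on it is assumed to be regular (so open sets are measurable). $B_\varepsilon(x)$ denotes the open $d$-ball of radius $\varepsilon$ about $x$. Two systems $(Y,\nu,T)$ and $(Y_1,\nu_1,S)$ are measure-theoretically isomorphic if, after discarding null sets (with forward-invariant complements), there is a bimeasurable bijection between them that carries $\nu$ to $\nu_1$ and intertwines $T$ and $S$. A system $(Y,\nu,T)$ is measurably sensitive if whenever $(Y_1,\nu_1,S)$ is measure-theoretically isomorphic to $(Y,\nu,T)$ and $d$ is a good metric on $Y_1$, there exists $\delta>0$ such that for all $x\in Y_1$ and all $\varepsilon>0$ there exists $N\in\mathbb{N}$ such that for all integers $n\ge N$, $\nu_1\{y\in B_\varepsilon(x): d(S^n(x),S^n(y))>\delta\}>0$.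 *)

theory Defs
  imports "HOL-Analysis.Analysis"
begin

section \<open>Isomorphism modulo null sets and Lebesgue spaces\<close>

text \<open>
  \<open>\<phi>\<close> is a bimeasurable, measure-preserving bijection between the conull sets \<open>A\<close> and \<open>B\<close>.
\<close>

definition iso_mod_null ::
  "'a measure \<Rightarrow> 'b measure \<Rightarrow> 'a set \<Rightarrow> 'b set \<Rightarrow> ('a \<Rightarrow> 'b) \<Rightarrow> bool" where
  "iso_mod_null M N A B \<phi> \<longleftrightarrow>
     A \<in> sets M \<and> space M - A \<in> null_sets M \<and>
     B \<in> sets N \<and> space N - B \<in> null_sets N \<and>
     bij_betw \<phi> A B \<and>
     \<phi> \<in> restrict_space M A \<rightarrow>\<^sub>M restrict_space N B \<and>
     inv_into A \<phi> \<in> restrict_space N B \<rightarrow>\<^sub>M restrict_space M A \<and>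
     distr (restrict_space M A) (restrict_space N B) \<phi> = restrict_space N B"

text \<open>
  A non-atomic Lebesgue space is a complete measure space that is isomorphic modulo null sets to
  an interval of the real line (bounded or not) with Lebesgue measure.
\<close>

definition nonatomic_lebesgue_space :: "'a measure \<Rightarrow> bool" where
  "nonatomic_lebesgue_space M \<longleftrightarrow>
     complete_measure M \<and>
     (\<exists>(I::real set) A B \<phi>. is_interval I \<and> iso_mod_null M (lebesgue_on I) A B \<phi>)"


section \<open>Dynamical systems\<close>

definition measure_preserving_map :: "'a measure \<Rightarrow> ('a \<Rightarrow> 'a) \<Rightarrow> bool" where
  "measure_preserving_map M T \<longleftrightarrow> T \<in> M \<rightarrow>\<^sub>M M \<and> distr M M T = M"

definition lightly_mixing :: "'a measure \<Rightarrow> ('a \<Rightarrow> 'a) \<Rightarrow> bool" where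
  "lightly_mixing M T \<longleftrightarrow>
     (\<forall>A\<in>sets M. \<forall>B\<in>sets M. 0 < emeasure M A \<longrightarrow> 0 < emeasure M B \<longrightarrow>
        0 < liminf (\<lambda>n. emeasure M (((T ^^ n) -` A \<inter> space M) \<inter> B)))"

definition ergodic :: "'a measure \<Rightarrow> ('a \<Rightarrow> 'a) \<Rightarrow> bool" where
  "ergodic M T \<longleftrightarrow>
     (\<forall>A\<in>sets M. T -` A \<inter> space M = A \<longrightarrow>
        emeasure M A = 0 \<or> emeasure M (space M - A) = 0)"

text \<open>Eigenvalues are complex numbers, with complex-valued \<open>L\<^sup>\<infinity>\<close> eigenfunctions.\<close>

definition Linfty_eigenvalue :: "'a measure \<Rightarrow> ('a \<Rightarrow> 'a) \<Rightarrow> complex \<Rightarrow> bool" where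
  "Linfty_eigenvalue M T l \<longleftrightarrow>
     (\<exists>f :: 'a \<Rightarrow> complex.
        f \<in> borel_measurable M \<and> (\<exists>C. AE x in M. norm (f x) \<le> C) \<and>
        (AE x in M. f x \<noteq> 0) \<and> (AE x in M. f (T x) = l * f x))"

definition weakly_mixing :: "'a measure \<Rightarrow> ('a \<Rightarrow> 'a) \<Rightarrow> bool" where
  "weakly_mixing M T \<longleftrightarrow> ergodic M T \<and> {l. Linfty_eigenvalue M T l} = {1}"

text \<open>The conull sets on which the isomorphism lives are forward invariant.\<close>

definition isomorphic_systems ::
  "'a measure \<Rightarrow> ('a \<Rightarrow> 'a) \<Rightarrow> 'b measure \<Rightarrow> ('b \<Rightarrow> 'b) \<Rightarrow> bool" where
  "isomorphic_systems M T N S \<longleftrightarrow>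
     (\<exists>A B \<phi>. iso_mod_null M N A B \<phi> \<and> T ` A \<subseteq> A \<and> S ` B \<subseteq> B \<and>
        (\<forall>x\<in>A. \<phi> (T x) = S (\<phi> x)))"


section \<open>Good metrics and measurable sensitivity\<close>

text \<open>
  Regularity with respect to the topology of a metric: open sets are measurable, and every
  measurable set is approximated from outside by open sets and from inside by closed sets.
  On finite measure spaces this is implied by the variant with compact inner approximation.
\<close>

definition regular_wrt_metric :: "'a measure \<Rightarrow> ('a \<Rightarrow> 'a \<Rightarrow> real) \<Rightarrow> bool" where
  "regular_wrt_metric M d \<longleftrightarrow>
     (\<forall>U. openin (Metric_space.mtopology (space M) d) U \<longrightarrow> U \<in> sets M) \<and>
     (\<forall>A\<in>sets M.
        emeasure M A =
          (INF U\<in>{U. openin (Metric_space.mtopology (space M) d) U \<and> A \<subseteq> U}. emeasure M U) \<and>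
        emeasure M A =
          (SUP F\<in>{F. closedin (Metric_space.mtopology (space M) d) F \<and> F \<subseteq> A}. emeasure M F))"

definition good_metric :: "'a measure \<Rightarrow> ('a \<Rightarrow> 'a \<Rightarrow> real) \<Rightarrow> bool" where
  "good_metric M d \<longleftrightarrow>
     Metric_space (space M) d \<and> regular_wrt_metric M d \<and>
     (\<forall>U. openin (Metric_space.mtopology (space M) d) U \<longrightarrow> U \<noteq> {} \<longrightarrow> 0 < emeasure M U)"

text \<open>
  A definition cannot quantify over types, so the type \<open>'b\<close> of the points of the isomorphic
  systems is a parameter. Measurable sensitivity is the validity of
  \<open>measurably_sensitive TYPE('b) M T\<close> for every type \<open>'b\<close>; a theorem with \<open>'b\<close> free says this.
\<close>

definition measurably_sensitive :: "'b itself \<Rightarrow> 'a measure \<Rightarrow> ('a \<Rightarrow> 'a) \<Rightarrow> bool" where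
  "measurably_sensitive TYPE('b) M T \<longleftrightarrow>
     (\<forall>(N :: 'b measure) S d.
        S \<in> N \<rightarrow>\<^sub>M N \<longrightarrow> isomorphic_systems M T N S \<longrightarrow> good_metric N d \<longrightarrow>
        (\<exists>\<delta>>0. \<forall>x\<in>space N. \<forall>\<epsilon>>0. \<exists>n\<^sub>0. \<forall>n\<ge>n\<^sub>0.
           0 < emeasure N
             {y \<in> Metric_space.mball (space N) d x \<epsilon>. d ((S ^^ n) x) ((S ^^ n) y) > \<delta>}))"


section \<open>The rotation on two points\<close>

text \<open>The common mass \<open>c\<close> of the two points is left as a parameter.\<close>

definition two_point_space :: "real \<Rightarrow> nat measure" where
  "two_point_space c = point_measure {1, 2} (\<lambda>_. ennreal c)"

definition two_point_rotation :: "nat \<Rightarrow> nat" where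
  "two_point_rotation i = (if i = 1 then 2 else 1)"

end

theory Submission
  imports Defs
begin

text \<open>
  For sensitivity, let \<open>d\<close> be a good metric on an isomorphic copy and let \<open>E\<^sub>1\<close>, \<open>E\<^sub>2\<close> be the copies
  of \<open>X \<times> {1}\<close> and \<open>X \<times> {2}\<close>. Balls have positive measure and the measure is finite, so the metric
  is separable; as there are no atoms, each \<open>E\<^sub>i\<close> contains two sets \<open>U\<^sub>i\<close>, \<open>V\<^sub>i\<close> of positive measure at
  distance \<open>r\<^sub>i > 0\<close>. By light mixing, for all large \<open>n\<close> the \<open>n\<close>-th image of a given ball meets both
  \<open>U\<^sub>i\<close> and \<open>V\<^sub>i\<close> for one of the indices \<open>i\<close>, with positive measure of the preimages, and the image of
  the centre cannot be within \<open>r\<^sub>i / 3\<close> of points of both. For ergodicity, the slices of an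
  invariant set are invariant under \<open>T\<^sub>1\<^sup>2\<close>, which is ergodic by light mixing along even times.
  The function that is \<open>1\<close> on \<open>X \<times> {1}\<close> and \<open>-1\<close> on \<open>X \<times> {2}\<close> has the eigenvalue \<open>-1\<close>.
\<close>

section \<open>Good metrics on finite measure spaces\<close>

text \<open>The finite partial sums of the measures are bounded by the total mass, so the family is
  summable, and a summable family has only countably many nonzero terms.\<close>

lemma (in finite_measure) countable_disjoint_positive:
  assumes "disjoint_family_on F C"
    and "\<And>x. x \<in> C \<Longrightarrow> F x \<in> sets M" "\<And>x. x \<in> C \<Longrightarrow> 0 < measure M (F x)"
  shows "countable C"
proof -
  have "(\<lambda>x. norm (measure M (F x))) summable_on C"
  proof (rule nonneg_bdd_above_summable_on)
    show "bdd_above (sum (\<lambda>x. norm (measure M (F x))) ` {D. D \<subseteq> C \<and> finite D})"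
    proof (rule bdd_aboveI2)
      fix D assume D: "D \<in> {D. D \<subseteq> C \<and> finite D}"
      then have "measure M (\<Union>x\<in>D. F x) = (\<Sum>x\<in>D. measure M (F x))"
        using assms by (intro finite_measure_finite_Union)
          (auto intro: disjoint_family_on_mono)
      then show "(\<Sum>x\<in>D. norm (measure M (F x))) \<le> measure M (space M)"
        using bounded_measure[of "\<Union>x\<in>D. F x"] by simp
    qed
  qed auto
  then have "countable {x\<in>C. measure M (F x) \<noteq> 0}"
    by (rule abs_summable_countable)
  moreover have "{x\<in>C. measure M (F x) \<noteq> 0} = C"
    using assms(3) by force
  ultimately show ?thesis by simp
qed

text \<open>Zorn's lemma yields a separated set that is maximal under inclusion; a point far from
  all of it could still be added. As \<open>d\<close> is an arbitrary function here, closeness is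
  known in only one of the two orders.\<close>

lemma maximal_separated_subset:
  fixes d :: "'a \<Rightarrow> 'a \<Rightarrow> real"
  obtains C where "C \<subseteq> X" "\<And>x y. x \<in> C \<Longrightarrow> y \<in> C \<Longrightarrow> x \<noteq> y \<Longrightarrow> r \<le> d x y"
    "\<And>z. z \<in> X \<Longrightarrow> z \<notin> C \<Longrightarrow> \<exists>x\<in>C. d x z < r \<or> d z x < r"
proof -
  define P where "P = {C. C \<subseteq> X \<and> (\<forall>x\<in>C. \<forall>y\<in>C. x \<noteq> y \<longrightarrow> r \<le> d x y)}"
  have "\<exists>C\<in>P. \<forall>D\<in>P. C \<subseteq> D \<longrightarrow> D = C"
  proof (rule subset_Zorn')
    fix K assume K: "subset.chain P K"
    have "r \<le> d x y" if "x \<in> \<Union>K" "y \<in> \<Union>K" "x \<noteq> y" for x y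
    proof -
      from that(1,2) obtain C D where "C \<in> K" "x \<in> C" "D \<in> K" "y \<in> D" by blast
      then have "\<exists>C\<in>K. x \<in> C \<and> y \<in> C" using K unfolding subset_chain_def by blast
      then show ?thesis using K that(3) unfolding subset_chain_def P_def by blast
    qed
    then show "\<Union>K \<in> P" using K unfolding subset_chain_def P_def by blast
  qed
  then obtain C where C: "C \<in> P" "\<And>D. D \<in> P \<Longrightarrow> C \<subseteq> D \<Longrightarrow> D = C" by blast
  show thesis
  proof (rule that[of C])
    fix z assume z: "z \<in> X" "z \<notin> C"
    then have "insert z C \<notin> P" using C(2)[of "insert z C"] by blast
    then show "\<exists>x\<in>C. d x z < r \<or> d z x < r"
      using z C(1) unfolding P_def by clarsimp (meson not_le)
  qed (use C(1) in \<open>auto simp: P_def\<close>)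
qed

text \<open>The balls of radius \<open>r/2\<close> about a maximal \<open>r\<close>-separated set
  are disjoint and of positive measure, hence countably many. The balls of radius \<open>r\<close>
  about the same centres cover \<open>E\<close>, so they cannot all meet it in null sets.\<close>

lemma (in finite_measure) ball_meets_positive:
  assumes gm: "good_metric M d"
    and E: "E \<in> sets M" "0 < emeasure M E" and r: "0 < r"
  obtains x where "x \<in> space M" "0 < emeasure M (Metric_space.mball (space M) d x r \<inter> E)"
proof -
  interpret Metric_space "space M" d using gm by (simp add: good_metric_def)
  have ball[measurable]: "mball x e \<in> sets M" for x e
    using gm by (auto simp: good_metric_def regular_wrt_metric_def)
  have pos: "0 < emeasure M (mball x e)" if "x \<in> space M" "0 < e" for x e
  proof -
    have "mball x e \<noteq> {}" using that centre_in_mball_iff by blast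
    then show ?thesis using gm by (auto simp: good_metric_def)
  qed
  obtain C where C: "C \<subseteq> space M" "\<And>x y. x \<in> C \<Longrightarrow> y \<in> C \<Longrightarrow> x \<noteq> y \<Longrightarrow> r \<le> d x y"
    "\<And>z. z \<in> space M \<Longrightarrow> z \<notin> C \<Longrightarrow> \<exists>x\<in>C. d x z < r \<or> d z x < r"
    by (rule maximal_separated_subset[of "space M" r d]) blast
  have "countable C"
  proof (rule countable_disjoint_positive)
    show "disjoint_family_on (\<lambda>x. mball x (r/2)) C"
      unfolding disjoint_family_on_def
    proof (intro ballI impI)
      fix x y assume xy: "x \<in> C" "y \<in> C" "x \<noteq> y"
      have False if "z \<in> mball x (r/2)" "z \<in> mball y (r/2)" for z
        using that C(2)[OF xy] triangle[of x z y] by (auto simp: commute[of y z])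
      then show "mball x (r/2) \<inter> mball y (r/2) = {}" by blast
    qed
    show "0 < measure M (mball x (r/2))" if "x \<in> C" for x
      using pos[of x "r/2"] that C(1) r by (auto simp: emeasure_eq_measure)
  qed auto
  have cover: "E \<subseteq> (\<Union>x\<in>C. mball x r \<inter> E)"
  proof
    fix z assume z: "z \<in> E"
    then have zs: "z \<in> space M" using E sets.sets_into_space by blast
    have "\<exists>x\<in>C. d x z < r"
      using C(3)[OF zs] r zs mdist_zero[of z] commute by (cases "z \<in> C") (metis, fastforce)
    then show "z \<in> (\<Union>x\<in>C. mball x r \<inter> E)" using z zs C(1) by auto
  qed
  have "\<exists>x\<in>C. emeasure M (mball x r \<inter> E) \<noteq> 0"
  proof (rule ccontr)
    assume "\<not> ?thesis"
    then have "(\<Union>x\<in>C. mball x r \<inter> E) \<in> null_sets M"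
      using \<open>countable C\<close> E by (intro null_sets_UN') auto
    then have "emeasure M E = 0"
      using cover E by (metis null_sets_subset null_setsD1)
    then show False using E by simp
  qed
  then obtain x where "x \<in> C" "0 < emeasure M (mball x r \<inter> E)"
    using zero_less_iff_neq_zero by blast
  with that C(1) show thesis by blast
qed

text \<open>Otherwise, whenever a ball meets \<open>E\<close> in positive measure, the part of
  \<open>E\<close> outside the concentric ball of twice the radius is null. Radii tending to 0
  squeeze almost all of \<open>E\<close> into at most one point, against
  \<open>null\<close>.\<close>

lemma (in finite_measure) separated_positive_subsets:
  assumes gm: "good_metric M d"
    and null: "\<And>Z. Z \<in> sets M \<Longrightarrow> (\<And>x y. x \<in> Z \<Longrightarrow> y \<in> Z \<Longrightarrow> x = y) \<Longrightarrow> emeasure M Z = 0"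
    and E: "E \<in> sets M" "0 < emeasure M E"
  obtains U V r where "U \<in> sets M" "U \<subseteq> E" "0 < emeasure M U"
    "V \<in> sets M" "V \<subseteq> E" "0 < emeasure M V"
    "0 < r" "\<And>u v. u \<in> U \<Longrightarrow> v \<in> V \<Longrightarrow> r \<le> d u v"
proof (rule ccontr)
  assume "\<not> thesis"
  \<comment> \<open>\<open>no\<close> gives a contradiction from any two subsets of \<open>E\<close>
    of positive measure at positive distance.\<close>
  note no = this[unfolded not_def, rule_format, OF that]
  interpret Metric_space "space M" d using gm by (simp add: good_metric_def)
  have ball[measurable]: "mball x e \<in> sets M" for x e
    using gm by (auto simp: good_metric_def regular_wrt_metric_def)
  have [measurable]: "E \<in> sets M" by fact
  define e where "e n = 1 / real (Suc n)" for n
  have e: "0 < e n" for n by (simp add: e_def)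
  have "\<exists>x. x \<in> space M \<and> 0 < emeasure M (mball x (e n) \<inter> E)" for n
    by (rule ball_meets_positive[OF gm E e[of n]]) blast
  then obtain x where x: "x n \<in> space M" "0 < emeasure M (mball (x n) (e n) \<inter> E)" for n
    by metis
  have out: "E - mball (x n) (2 * e n) \<in> null_sets M" for n
  proof -
    have dist: "e n \<le> d u v"
      if "u \<in> mball (x n) (e n) \<inter> E" "v \<in> E - mball (x n) (2 * e n)" for u v
    proof -
      have "v \<in> space M" using that E sets.sets_into_space by blast
      then show ?thesis using that triangle[of "x n" u v] x(1)[of n] by auto
    qed
    have "\<not> 0 < emeasure M (E - mball (x n) (2 * e n))"
    proof
      assume "0 < emeasure M (E - mball (x n) (2 * e n))"
      from no[OF _ _ x(2) _ _ this e dist] show False by auto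
    qed
    then have "emeasure M (E - mball (x n) (2 * e n)) = 0"
      using zero_less_iff_neq_zero by blast
    then show ?thesis by (auto intro: null_setsI)
  qed
  \<comment> \<open>\<open>Z\<close> is \<open>E\<close> up to a null set and lies in every ball of
    radius \<open>2 * e n\<close>, so any two of its points are closer than
    \<open>4 * e n\<close>.\<close>
  define Z where "Z = E - (\<Union>n. E - mball (x n) (2 * e n))"
  have "emeasure M Z = emeasure M E"
    unfolding Z_def using E(1)
    by (intro emeasure_Diff_null_set null_sets_UN' out) auto
  moreover have "emeasure M Z = 0"
  proof (rule null)
    show "Z \<in> sets M" unfolding Z_def by measurable
    fix y z assume yz: "y \<in> Z" "z \<in> Z"
    then have s: "y \<in> space M" "z \<in> space M"
      using E sets.sets_into_space unfolding Z_def by blast+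
    have "d y z < 4 * e n" for n
    proof -
      have "y \<in> mball (x n) (2 * e n)" "z \<in> mball (x n) (2 * e n)"
        using yz unfolding Z_def by blast+
      then show ?thesis using triangle[of y "x n" z] by (auto simp: commute[of y])
    qed
    moreover have "\<exists>n. 4 * e n < d y z" if "0 < d y z"
    proof -
      obtain n where "inverse (real (Suc n)) < d y z / 4"
        using reals_Archimedean[of "d y z / 4"] \<open>0 < d y z\<close>
        by (metis divide_pos_pos zero_less_numeral)
      then have "4 * e n < d y z" by (simp add: e_def inverse_eq_divide)
      then show ?thesis by blast
    qed
    ultimately have "\<not> 0 < d y z" by (meson less_asym)
    then show "y = z" using s nonneg[of y z] zero[OF s] by auto
  qed
  ultimately show False using E by simp
qed


section \<open>Isomorphisms modulo null sets\<close>

text \<open>As \<open>\<phi>\<close> maps \<open>A\<close> into \<open>B\<close>, the sets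
  \<open>W\<close> and \<open>W \<inter> B\<close> have the same preimage in \<open>A\<close>, and
  they differ by a null set. For \<open>W \<inter> B\<close> the equality of measures is the
  condition on the image measure.\<close>

lemma iso_mod_null_vimage:
  assumes iso: "iso_mod_null M N A B \<phi>" and W: "W \<in> sets N"
  shows "\<phi> -` W \<inter> A \<in> sets M" "emeasure M (\<phi> -` W \<inter> A) = emeasure N W"
proof -
  note iso' = iso[unfolded iso_mod_null_def]
  have A: "A \<in> sets M" and B: "B \<in> sets N" and Bn: "space N - B \<in> null_sets N"
    and bij: "bij_betw \<phi> A B"
    and m: "\<phi> \<in> restrict_space M A \<rightarrow>\<^sub>M restrict_space N B"
    and d: "distr (restrict_space M A) (restrict_space N B) \<phi> = restrict_space N B"
    using iso' by auto
  have sA: "A \<inter> space M = A" "B \<inter> space N = B"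
    using A B sets.sets_into_space by blast+
  have WB: "W \<inter> B \<in> sets (restrict_space N B)"
    using W B by (auto simp: sets_restrict_space)
  have eq: "\<phi> -` (W \<inter> B) \<inter> space (restrict_space M A) = \<phi> -` W \<inter> A"
    using bij sA by (auto simp: space_restrict_space bij_betw_def)
  have "\<phi> -` W \<inter> A \<in> sets (restrict_space M A)"
    using measurable_sets[OF m WB] eq by simp
  then show s: "\<phi> -` W \<inter> A \<in> sets M"
    using A sA by (simp add: sets_restrict_space_iff)
  have "emeasure (restrict_space N B) (W \<inter> B) = emeasure (restrict_space M A) (\<phi> -` W \<inter> A)"
    using emeasure_distr[OF m WB] eq d by simp
  moreover have "emeasure (restrict_space N B) (W \<inter> B) = emeasure N (W \<inter> B)"
    using B sA by (intro emeasure_restrict_space) auto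
  moreover have "emeasure (restrict_space M A) (\<phi> -` W \<inter> A) = emeasure M (\<phi> -` W \<inter> A)"
    using A sA by (intro emeasure_restrict_space) auto
  moreover have "emeasure N (W - (space N - B)) = emeasure N W"
    using W Bn by (rule emeasure_Diff_null_set[rotated])
  moreover have "W - (space N - B) = W \<inter> B" using W sets.sets_into_space by blast
  ultimately show "emeasure M (\<phi> -` W \<inter> A) = emeasure N W" by simp
qed

text \<open>The image is a preimage under \<open>inv_into A \<phi>\<close>, hence measurable; by
  injectivity it pulls back to \<open>E \<inter> A\<close>, which gives its measure.\<close>

lemma iso_mod_null_image:
  assumes iso: "iso_mod_null M N A B \<phi>" and E: "E \<in> sets M"
  shows "\<phi> ` (E \<inter> A) \<in> sets N" "emeasure N (\<phi> ` (E \<inter> A)) = emeasure M E"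
proof -
  note iso' = iso[unfolded iso_mod_null_def]
  have A: "A \<in> sets M" and B: "B \<in> sets N" and An: "space M - A \<in> null_sets M"
    and bij: "bij_betw \<phi> A B"
    and m: "inv_into A \<phi> \<in> restrict_space N B \<rightarrow>\<^sub>M restrict_space M A"
    using iso' by auto
  have sA: "A \<inter> space M = A" "B \<inter> space N = B"
    using A B sets.sets_into_space by blast+
  have "E \<inter> A \<in> sets (restrict_space M A)"
    using E A by (auto simp: sets_restrict_space)
  from measurable_sets[OF m this]
  have "inv_into A \<phi> -` (E \<inter> A) \<inter> B \<in> sets (restrict_space N B)"
    using sA by (simp add: space_restrict_space)
  moreover have "inv_into A \<phi> -` (E \<inter> A) \<inter> B = \<phi> ` (E \<inter> A)"
    using bij by (force simp: bij_betw_def)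
  ultimately show s: "\<phi> ` (E \<inter> A) \<in> sets N"
    using B sA by (simp add: sets_restrict_space_iff)
  have "\<phi> -` \<phi> ` (E \<inter> A) \<inter> A = E \<inter> A"
    using bij by (auto simp: bij_betw_def dest: inj_onD)
  also have "\<dots> = E - (space M - A)" using E sets.sets_into_space by blast
  finally show "emeasure N (\<phi> ` (E \<inter> A)) = emeasure M E"
    using iso_mod_null_vimage(2)[OF iso s] emeasure_Diff_null_set[OF An E] by simp
qed

text \<open>The singleton corresponds to at most one real number, and Lebesgue measure vanishes on
  finite sets.\<close>

lemma nonatomic_lebesgue_space_singleton:
  assumes "nonatomic_lebesgue_space M" "{a} \<in> sets M"
  shows "emeasure M {a} = 0"
proof -
  obtain I :: "real set" and A B \<phi> where iso: "iso_mod_null M (lebesgue_on I) A B \<phi>"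
    and I: "is_interval I"
    using assms(1) unfolding nonatomic_lebesgue_space_def by blast
  have I: "I \<in> sets lebesgue"
    using real_interval_borel_measurable[OF I] by simp
  have fin: "finite (\<phi> ` ({a} \<inter> A))" by simp
  have "emeasure M {a} = emeasure (lebesgue_on I) (\<phi> ` ({a} \<inter> A))"
    using iso_mod_null_image(2)[OF iso assms(2)] by simp
  also have "\<dots> = emeasure lebesgue (\<phi> ` ({a} \<inter> A))"
    using iso_mod_null_image(1)[OF iso assms(2)] I
    by (intro emeasure_restrict_space) (auto simp: sets_restrict_space)
  also have "\<dots> = 0" using negligible_finite[OF fin]
    by (simp add: negligible_iff_null_sets null_setsD1)
  finally show ?thesis .
qed


section \<open>Sensitivity from recurrent visits\<close>

text \<open>
  The index sequence \<open>k\<close> depends only on \<open>G\<close>, so for one and the same index two families \<open>U\<close> and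
  \<open>V\<close> are visited at the same time.
\<close>

definition eventually_visits ::
  "'a measure \<Rightarrow> ('a \<Rightarrow> 'a) \<Rightarrow> 'i set \<Rightarrow> ('i \<Rightarrow> 'a set) \<Rightarrow> bool" where
  "eventually_visits M T I E \<longleftrightarrow>
     (\<forall>G\<in>sets M. 0 < emeasure M G \<longrightarrow>
       (\<exists>k. range k \<subseteq> I \<and>
         (\<forall>U. (\<forall>i\<in>I. U i \<in> sets M \<and> U i \<subseteq> E i \<and> 0 < emeasure M (U i)) \<longrightarrow>
           (\<forall>\<^sub>F n::nat in sequentially. 0 < emeasure M ((T ^^ n) -` U (k n) \<inter> G)))))"

lemma measurable_funpow:
  assumes "T \<in> M \<rightarrow>\<^sub>M M" shows "T ^^ n \<in> M \<rightarrow>\<^sub>M M"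
  by (induction n) (use assms in \<open>auto simp: comp_def intro: measurable_compose\<close>)

text \<open>\<open>G\<close> and the sets \<open>U i\<close> are pulled back along
  \<open>\<phi>\<close>, which preserves their measures; the index sequence is taken over
  unchanged.\<close>

lemma eventually_visits_iso:
  assumes iso: "iso_mod_null M N A B \<phi>" and TA: "T ` A \<subseteq> A"
    and eq: "\<forall>x\<in>A. \<phi> (T x) = S (\<phi> x)" and S: "S \<in> N \<rightarrow>\<^sub>M N"
    and vis: "eventually_visits M T I E"
  shows "eventually_visits N S I (\<lambda>i. \<phi> ` (E i \<inter> A))"
  unfolding eventually_visits_def
proof (intro ballI impI)
  fix G assume G: "G \<in> sets N" "0 < emeasure N G"
  have inj: "inj_on \<phi> A" using iso by (auto simp: iso_mod_null_def bij_betw_def)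
  \<comment> \<open>Forward invariance keeps orbits inside \<open>A\<close>, so the intertwining
    passes to all iterates.\<close>
  have pow: "(T ^^ n) x \<in> A \<and> \<phi> ((T ^^ n) x) = (S ^^ n) (\<phi> x)" if "x \<in> A" for n x
    using that TA eq by (induction n) auto
  obtain k where k: "range k \<subseteq> I"
    "\<And>U. \<forall>i\<in>I. U i \<in> sets M \<and> U i \<subseteq> E i \<and> 0 < emeasure M (U i) \<Longrightarrow>
      \<forall>\<^sub>F n in sequentially. 0 < emeasure M ((T ^^ n) -` U (k n) \<inter> (\<phi> -` G \<inter> A))"
    using vis[unfolded eventually_visits_def, rule_format, of "\<phi> -` G \<inter> A"]
      iso_mod_null_vimage[OF iso G(1)] G(2) by auto
  show "\<exists>k. range k \<subseteq> I \<and>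
      (\<forall>U. (\<forall>i\<in>I. U i \<in> sets N \<and> U i \<subseteq> \<phi> ` (E i \<inter> A) \<and> 0 < emeasure N (U i)) \<longrightarrow>
        (\<forall>\<^sub>F n in sequentially. 0 < emeasure N ((S ^^ n) -` U (k n) \<inter> G)))"
  proof (intro exI conjI allI impI)
    fix U assume U: "\<forall>i\<in>I. U i \<in> sets N \<and> U i \<subseteq> \<phi> ` (E i \<inter> A) \<and> 0 < emeasure N (U i)"
    have "\<phi> -` U i \<inter> A \<subseteq> E i" if "i \<in> I" for i
      using U that inj by (fastforce dest: inj_onD)
    then have "\<forall>i\<in>I. \<phi> -` U i \<inter> A \<in> sets M \<and> \<phi> -` U i \<inter> A \<subseteq> E i \<and> 0 < emeasure M (\<phi> -` U i \<inter> A)"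
      using U iso_mod_null_vimage[OF iso] by auto
    from k(2)[OF this]
    show "\<forall>\<^sub>F n in sequentially. 0 < emeasure N ((S ^^ n) -` U (k n) \<inter> G)"
    proof eventually_elim
      case (elim n)
      have "U (k n) \<in> sets N" using U k(1) by blast
      moreover have "(S ^^ n) -` U (k n) \<inter> G = ((S ^^ n) -` U (k n) \<inter> space N) \<inter> G"
        using G sets.sets_into_space by blast
      ultimately have "(S ^^ n) -` U (k n) \<inter> G \<in> sets N"
        using measurable_sets[OF measurable_funpow[OF S]] G(1) by simp
      moreover have "(T ^^ n) -` (\<phi> -` U (k n) \<inter> A) \<inter> (\<phi> -` G \<inter> A) =
          \<phi> -` ((S ^^ n) -` U (k n) \<inter> G) \<inter> A"
        using pow by auto
      ultimately show ?case using elim iso_mod_null_vimage(2)[OF iso] by metis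
    qed
  qed (fact k(1))
qed

text \<open>\<open>\<delta>\<close> is built from one separated pair \<open>U i\<close>,
  \<open>V i\<close> in each \<open>E i\<close>, before \<open>x\<close> and
  \<open>\<epsilon>\<close> are given; finiteness of \<open>I\<close> makes it positive. At any time
  \<open>n\<close>, the image of the centre is far from all of \<open>U (k n)\<close> or from all of
  \<open>V (k n)\<close>.\<close>

lemma (in finite_measure) sensitive_if_eventually_visits:
  assumes gm: "good_metric M d" and S: "S \<in> M \<rightarrow>\<^sub>M M"
    and null: "\<And>Z. Z \<in> sets M \<Longrightarrow> (\<And>x y. x \<in> Z \<Longrightarrow> y \<in> Z \<Longrightarrow> x = y) \<Longrightarrow> emeasure M Z = 0"
    and I: "finite I" "\<And>i. i \<in> I \<Longrightarrow> E i \<in> sets M" "\<And>i. i \<in> I \<Longrightarrow> 0 < emeasure M (E i)"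
    and vis: "eventually_visits M S I E"
  shows "\<exists>\<delta>>0. \<forall>x\<in>space M. \<forall>\<epsilon>>0. \<exists>n\<^sub>0. \<forall>n\<ge>n\<^sub>0.
    0 < emeasure M {y \<in> Metric_space.mball (space M) d x \<epsilon>. d ((S ^^ n) x) ((S ^^ n) y) > \<delta>}"
proof -
  interpret Metric_space "space M" d using gm by (simp add: good_metric_def)
  have op: "W \<in> sets M" if "openin mtopology W" for W
    using gm that by (auto simp: good_metric_def regular_wrt_metric_def)
  have "\<exists>U V r. U \<in> sets M \<and> U \<subseteq> E i \<and> 0 < emeasure M U \<and> V \<in> sets M \<and> V \<subseteq> E i \<and>
      0 < emeasure M V \<and> 0 < r \<and> (\<forall>u\<in>U. \<forall>v\<in>V. r \<le> d u v)" if "i \<in> I" for i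
    by (rule separated_positive_subsets[OF gm null I(2)[OF that] I(3)[OF that]]) blast+
  then obtain U V r where
    U: "\<forall>i\<in>I. U i \<in> sets M \<and> U i \<subseteq> E i \<and> 0 < emeasure M (U i)" and
    V: "\<forall>i\<in>I. V i \<in> sets M \<and> V i \<subseteq> E i \<and> 0 < emeasure M (V i)" and
    r: "\<forall>i\<in>I. 0 < r i \<and> (\<forall>u\<in>U i. \<forall>v\<in>V i. r i \<le> d u v)"
    by metis
  \<comment> \<open>The inserted 1 keeps the minimum defined when \<open>I\<close> is empty; the
    divisor 3 makes two distances up to \<open>\<delta>\<close> add up to less than every
    \<open>r i\<close>.\<close>
  define \<delta> where "\<delta> = Min (insert 1 (r ` I)) / 3"
  have \<delta>: "0 < \<delta>" using I(1) r by (auto simp: \<delta>_def)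
  have r\<delta>: "3 * \<delta> \<le> r i" if "i \<in> I" for i
    using I(1) that by (auto simp: \<delta>_def)
  show ?thesis
  proof (intro exI[of _ \<delta>] conjI ballI allI impI)
    fix x and \<epsilon> :: real assume x: "x \<in> space M" and \<epsilon>: "0 < \<epsilon>"
    have "mball x \<epsilon> \<noteq> {}" using x \<epsilon> centre_in_mball_iff by blast
    then have Gpos: "0 < emeasure M (mball x \<epsilon>)"
      using gm by (auto simp: good_metric_def)
    have G: "mball x \<epsilon> \<in> sets M" by (intro op) auto
    obtain k where kI: "range k \<subseteq> I" and k:
      "\<And>U. \<forall>i\<in>I. U i \<in> sets M \<and> U i \<subseteq> E i \<and> 0 < emeasure M (U i) \<Longrightarrow>
        \<forall>\<^sub>F n in sequentially. 0 < emeasure M ((S ^^ n) -` U (k n) \<inter> mball x \<epsilon>)"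
      using vis[unfolded eventually_visits_def, rule_format, OF G Gpos] by blast
    \<comment> \<open>The sequence \<open>k\<close> was obtained before either family is inserted,
      so for each large \<open>n\<close> both \<open>U (k n)\<close> and \<open>V (k n)\<close> are
      visited, with one and the same index.\<close>
    have "\<forall>\<^sub>F n in sequentially.
        0 < emeasure M {y \<in> mball x \<epsilon>. d ((S ^^ n) x) ((S ^^ n) y) > \<delta>}"
      using k[OF U] k[OF V]
    proof eventually_elim
      case (elim n)
      let ?p = "(S ^^ n) x" and ?i = "k n"
      let ?D = "{y \<in> mball x \<epsilon>. d ?p ((S ^^ n) y) > \<delta>}"
      have i: "?i \<in> I" using kI by blast
      have Sn: "S ^^ n \<in> M \<rightarrow>\<^sub>M M" using S by (rule measurable_funpow)
      have maps: "(S ^^ n) y \<in> space M" if "y \<in> space M" for y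
        using measurable_space[OF Sn that] .
      have p: "?p \<in> space M" using x by (rule maps)
      \<comment> \<open>The condition becomes membership in the complement of a closed ball, which
        is open; this makes \<open>?D\<close> measurable.\<close>
      have out: "\<delta> < d ?p z \<longleftrightarrow> z \<in> space M - mcball ?p \<delta>" if "z \<in> space M" for z
        using that p by (simp only: in_mcball Diff_iff not_le de_Morgan_conj simp_thms)
      have "mball x \<epsilon> \<subseteq> space M" by (rule mball_subset_mspace)
      then have "?D = ((S ^^ n) -` (space M - mcball ?p \<delta>) \<inter> space M) \<inter> mball x \<epsilon>"
        using out maps by blast
      moreover have "space M - mcball ?p \<delta> \<in> sets M"
        using closedin_mcball[of ?p \<delta>] by (intro op) (auto simp: closedin_def)
      ultimately have D: "?D \<in> sets M" using measurable_sets[OF Sn] G by simp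
      have sp: "U ?i \<subseteq> space M" "V ?i \<subseteq> space M"
        using U V i sets.sets_into_space by blast+
      have "(\<forall>u\<in>U ?i. \<delta> < d ?p u) \<or> (\<forall>v\<in>V ?i. \<delta> < d ?p v)"
      proof (rule ccontr)
        assume "\<not> ?thesis"
        then obtain u v where uv: "u \<in> U ?i" "v \<in> V ?i" "d ?p u \<le> \<delta>" "d ?p v \<le> \<delta>"
          by (auto simp: not_less)
        then have s: "u \<in> space M" "v \<in> space M" using sp by blast+
        have "3 * \<delta> \<le> d u v" using r r\<delta>[OF i] i uv by force
        then show False using triangle[of u ?p v] s p uv \<delta> by (simp add: commute[of u])
      qed
      \<comment> \<open>Whichever of the two sets is far from \<open>?p\<close>, its visits lie in
        \<open>?D\<close> and have positive measure.\<close>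
      then have "(S ^^ n) -` U ?i \<inter> mball x \<epsilon> \<subseteq> ?D \<or> (S ^^ n) -` V ?i \<inter> mball x \<epsilon> \<subseteq> ?D"
        by blast
      then show ?case using elim emeasure_mono[OF _ D] by (meson less_le_trans)
    qed
    then show "\<exists>n\<^sub>0. \<forall>n\<ge>n\<^sub>0. 0 < emeasure M {y \<in> mball x \<epsilon>. d ((S ^^ n) x) ((S ^^ n) y) > \<delta>}"
      by (simp add: eventually_sequentially)
  qed (fact \<delta>)
qed

text \<open>The hypotheses of the criterion inside one space all pass along an isomorphism. Absence
  of atoms is stated for sets with at most one point because such sets pull back to sets of the same
  kind, possibly empty ones.\<close>

lemma measurably_sensitive_if_eventually_visits:
  assumes "finite_measure M"
    and null: "\<And>Z. Z \<in> sets M \<Longrightarrow> (\<And>x y. x \<in> Z \<Longrightarrow> y \<in> Z \<Longrightarrow> x = y) \<Longrightarrow> emeasure M Z = 0"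
    and I: "finite I" "\<And>i. i \<in> I \<Longrightarrow> E i \<in> sets M" "\<And>i. i \<in> I \<Longrightarrow> 0 < emeasure M (E i)"
    and vis: "eventually_visits M T I E"
  shows "measurably_sensitive TYPE('b) M T"
  unfolding measurably_sensitive_def
proof (intro allI impI)
  fix N :: "'b measure" and S d
  assume S: "S \<in> N \<rightarrow>\<^sub>M N" and "isomorphic_systems M T N S" and gm: "good_metric N d"
  then obtain A B \<phi> where iso: "iso_mod_null M N A B \<phi>"
    and TA: "T ` A \<subseteq> A" and eq: "\<forall>x\<in>A. \<phi> (T x) = S (\<phi> x)"
    unfolding isomorphic_systems_def by blast
  have "emeasure N (space N) \<noteq> \<infinity>"
    using iso_mod_null_vimage(2)[OF iso sets.top] finite_measure.emeasure_finite[OF assms(1)]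
    by (metis infinity_ennreal_def)
  then interpret N: finite_measure N by (rule finite_measureI)
  show "\<exists>\<delta>>0. \<forall>x\<in>space N. \<forall>\<epsilon>>0. \<exists>n\<^sub>0. \<forall>n\<ge>n\<^sub>0.
    0 < emeasure N {y \<in> Metric_space.mball (space N) d x \<epsilon>. d ((S ^^ n) x) ((S ^^ n) y) > \<delta>}"
  proof (rule N.sensitive_if_eventually_visits[OF gm S _ I(1)])
    show "eventually_visits N S I (\<lambda>i. \<phi> ` (E i \<inter> A))"
      by (rule eventually_visits_iso[OF iso TA eq S vis])
    show "\<phi> ` (E i \<inter> A) \<in> sets N" "0 < emeasure N (\<phi> ` (E i \<inter> A))" if "i \<in> I" for i
      using iso_mod_null_image[OF iso I(2)] I(3) that by auto
    fix Z assume Z: "Z \<in> sets N" and one: "\<And>x y. x \<in> Z \<Longrightarrow> y \<in> Z \<Longrightarrow> x = y"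
    have "inj_on \<phi> A" using iso by (auto simp: iso_mod_null_def bij_betw_def)
    then have "x = y" if "x \<in> \<phi> -` Z \<inter> A" "y \<in> \<phi> -` Z \<inter> A" for x y
      using that one by (auto dest: inj_onD)
    then show "emeasure N Z = 0"
      using null iso_mod_null_vimage[OF iso Z] by metis
  qed
qed


section \<open>The product with the rotation on two points\<close>

lemma space_two_point_space: "space (two_point_space c) = {1, 2}"
  by (simp add: two_point_space_def space_point_measure)

lemma sets_two_point_space: "sets (two_point_space c) = Pow {1, 2}"
  by (simp add: two_point_space_def sets_point_measure)

lemma emeasure_two_point_space:
  "i \<in> {1, 2} \<Longrightarrow> emeasure (two_point_space c) {i} = ennreal c"
  by (subst two_point_space_def, subst emeasure_point_measure_finite) auto

lemma finite_measure_two_point_space: "finite_measure (two_point_space c)"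
proof (rule finite_measureI)
  have "emeasure (two_point_space c) {1, 2} = 2 * ennreal c"
    by (subst two_point_space_def, subst emeasure_point_measure_finite) auto
  then show "emeasure (two_point_space c) (space (two_point_space c)) \<noteq> \<infinity>"
    by (simp add: space_two_point_space ennreal_mult_eq_top_iff)
qed

lemma two_point_rotation_mem: "two_point_rotation i \<in> {1, 2}"
  by (simp add: two_point_rotation_def)

lemma funpow_two_point_rotation_mem: "i \<in> {1, 2} \<Longrightarrow> (two_point_rotation ^^ n) i \<in> {1, 2}"
  by (cases n) (use two_point_rotation_mem in auto)

lemma funpow_map_prod:
  fixes f :: "'a \<Rightarrow> 'a" and g :: "'b \<Rightarrow> 'b"
  shows "(map_prod f g ^^ n) (x, y) = ((f ^^ n) x, (g ^^ n) y)"
  by (induction n) auto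

abbreviation slice :: "('a \<times> 'b) set \<Rightarrow> 'b \<Rightarrow> 'a set" where
  "slice W i \<equiv> (\<lambda>x. (x, i)) -` W"

lemma pair_two_point_decomp:
  assumes "W \<in> sets (M \<Otimes>\<^sub>M two_point_space c)"
  shows "W = slice W 1 \<times> {1} \<union> slice W 2 \<times> {2}"
proof -
  have "W \<subseteq> space M \<times> {1, 2}"
    using sets.sets_into_space[OF assms] by (simp add: space_pair_measure space_two_point_space)
  then show ?thesis by auto
qed

lemma emeasure_pair_two_point:
  assumes "A \<in> sets M" "i \<in> {1, 2}"
  shows "emeasure (M \<Otimes>\<^sub>M two_point_space c) (A \<times> {i}) = emeasure M A * ennreal c"
proof -
  interpret finite_measure "two_point_space c" by (rule finite_measure_two_point_space)
  show ?thesis using assms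
    by (subst emeasure_pair_measure_Times)
      (auto simp: emeasure_two_point_space sets_two_point_space)
qed

lemma emeasure_pair_two_point_eq_0:
  assumes W: "W \<in> sets (M \<Otimes>\<^sub>M two_point_space c)"
    and "\<And>i. i \<in> {1, 2} \<Longrightarrow> emeasure M (slice W i) = 0"
  shows "emeasure (M \<Otimes>\<^sub>M two_point_space c) W = 0"
proof -
  have "slice W i \<times> {i} \<in> null_sets (M \<Otimes>\<^sub>M two_point_space c)" if "i \<in> {1, 2}" for i
    using that assms(2) emeasure_pair_two_point[OF sets_Pair2[OF W] that]
    by (auto intro!: null_setsI sets_Pair2[OF W] pair_measureI simp: sets_two_point_space)
  then have "slice W 1 \<times> {1} \<union> slice W 2 \<times> {2} \<in> null_sets (M \<Otimes>\<^sub>M two_point_space c)"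
    by (intro null_sets.Un) auto
  then show ?thesis using pair_two_point_decomp[OF W] by (metis null_setsD1)
qed

section \<open>Visits to the two levels under light mixing\<close>

lemma lightly_mixingD:
  assumes "lightly_mixing M T" "A \<in> sets M" "B \<in> sets M" "0 < emeasure M A" "0 < emeasure M B"
  shows "\<forall>\<^sub>F n in sequentially. 0 < emeasure M ((T ^^ n) -` A \<inter> space M \<inter> B)"
  using assms unfolding lightly_mixing_def by (intro less_LiminfD) blast

text \<open>The second coordinate moves deterministically: points starting on level \<open>j\<close>
  are on level \<open>k n\<close> at time \<open>n\<close>. Visits to \<open>U (k n)\<close> thus
  reduce to the first coordinate, where light mixing applies to slices.\<close>

lemma eventually_visits_two_point:
  assumes lm: "lightly_mixing M T" and T: "T \<in> M \<rightarrow>\<^sub>M M" and c: "0 < c"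
  shows "eventually_visits (M \<Otimes>\<^sub>M two_point_space c) (map_prod T two_point_rotation)
    {1, 2} (\<lambda>i. space M \<times> {i})"
  unfolding eventually_visits_def
proof (intro ballI impI)
  let ?P = "M \<Otimes>\<^sub>M two_point_space c" and ?T = "map_prod T two_point_rotation"
  fix G assume G: "G \<in> sets ?P" "0 < emeasure ?P G"
  \<comment> \<open>By contraposition, a set of positive measure has a slice of positive
    measure.\<close>
  obtain j where j: "j \<in> {1, 2}" and Gj: "0 < emeasure M (slice G j)"
    using emeasure_pair_two_point_eq_0[OF G(1)] G(2) by (metis zero_less_iff_neq_zero)
  define k where "k n = (two_point_rotation ^^ n) j" for n
  have kI: "k n \<in> {1, 2}" for n unfolding k_def using j by (rule funpow_two_point_rotation_mem)
  show "\<exists>k. range k \<subseteq> {1, 2} \<and>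
      (\<forall>U. (\<forall>i\<in>{1, 2}. U i \<in> sets ?P \<and> U i \<subseteq> space M \<times> {i} \<and> 0 < emeasure ?P (U i)) \<longrightarrow>
        (\<forall>\<^sub>F n in sequentially. 0 < emeasure ?P ((?T ^^ n) -` U (k n) \<inter> G)))"
  proof (intro exI[of _ k] conjI allI impI)
    fix U assume U: "\<forall>i\<in>{1, 2}. U i \<in> sets ?P \<and> U i \<subseteq> space M \<times> {i} \<and> 0 < emeasure ?P (U i)"
    have Ui: "slice (U i) i \<in> sets M" "0 < emeasure M (slice (U i) i)" if i: "i \<in> {1, 2}" for i
    proof -
      show s: "slice (U i) i \<in> sets M" using U i by (auto intro: sets_Pair2)
      have "U i = slice (U i) i \<times> {i}" using U i by fastforce
      then have "emeasure ?P (U i) = emeasure M (slice (U i) i) * ennreal c"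
        using emeasure_pair_two_point[OF s i] by metis
      then show "0 < emeasure M (slice (U i) i)"
        using U i by (metis mult_zero_left zero_less_iff_neq_zero)
    qed
    \<comment> \<open>Both levels are secured at once, since \<open>k n\<close> varies with
      \<open>n\<close>.\<close>
    have "\<forall>\<^sub>F n in sequentially. \<forall>i\<in>{1, 2}.
        0 < emeasure M ((T ^^ n) -` slice (U i) i \<inter> space M \<inter> slice G j)"
      by (intro eventually_ball_finite ballI lightly_mixingD[OF lm] Ui Gj sets_Pair2[OF G(1)]) auto
    then show "\<forall>\<^sub>F n in sequentially. 0 < emeasure ?P ((?T ^^ n) -` U (k n) \<inter> G)"
    proof eventually_elim
      case (elim n)
      let ?H = "(T ^^ n) -` slice (U (k n)) (k n) \<inter> space M \<inter> slice G j"
      have H: "?H \<in> sets M"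
        using measurable_sets[OF measurable_funpow[OF T] Ui(1)[OF kI]] sets_Pair2[OF G(1)]
        by (rule sets.Int)
      \<comment> \<open>The visits from level \<open>j\<close> alone already have positive
        measure.\<close>
      have "0 < emeasure ?P (?H \<times> {j})"
        using elim kI[of n] c
        by (subst emeasure_pair_two_point[OF H j]) (auto simp: ennreal_zero_less_mult_iff)
      moreover have "?H \<times> {j} \<subseteq> (?T ^^ n) -` U (k n) \<inter> G"
        by (auto simp: funpow_map_prod k_def)
      moreover have "(?T ^^ n) -` U (k n) \<inter> G \<in> sets ?P"
      proof -
        have "two_point_rotation \<in> two_point_space c \<rightarrow>\<^sub>M two_point_space c"
          using two_point_rotation_mem by (simp add: two_point_space_def space_point_measure)
        then have "?T \<in> ?P \<rightarrow>\<^sub>M ?P"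
          using T by (auto simp: map_prod_def case_prod_unfold intro!: measurable_Pair
              measurable_compose[OF measurable_fst] measurable_compose[OF measurable_snd])
        from measurable_sets[OF measurable_funpow[OF this]]
        have "(?T ^^ n) -` U (k n) \<inter> space ?P \<inter> G \<in> sets ?P"
          using U kI[of n] G(1) by blast
        moreover have "(?T ^^ n) -` U (k n) \<inter> space ?P \<inter> G = (?T ^^ n) -` U (k n) \<inter> G"
          using sets.sets_into_space[OF G(1)] by blast
        ultimately show ?thesis by simp
      qed
      ultimately show ?case by (meson emeasure_mono less_le_trans)
    qed
  qed (use kI in blast)
qed

section \<open>Ergodicity and the eigenvalue -1\<close>

text \<open>If \<open>A\<close> and its complement both had positive measure, the preimage of
  \<open>A\<close> under \<open>T ^^ n\<close> would meet the complement for all large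
  \<open>n\<close>; but for multiples of \<open>m\<close> this preimage is \<open>A\<close>
  itself.\<close>

lemma ergodic_funpow_if_lightly_mixing:
  assumes lm: "lightly_mixing M T" and T: "T \<in> M \<rightarrow>\<^sub>M M" and m: "0 < m"
  shows "ergodic M (T ^^ m)"
  unfolding ergodic_def
proof (intro ballI impI, rule ccontr)
  fix A assume A: "A \<in> sets M" and inv: "(T ^^ m) -` A \<inter> space M = A"
    and "\<not> (emeasure M A = 0 \<or> emeasure M (space M - A) = 0)"
  then have "\<forall>\<^sub>F n in sequentially. 0 < emeasure M ((T ^^ n) -` A \<inter> space M \<inter> (space M - A))"
    by (intro lightly_mixingD[OF lm]) (auto simp: zero_less_iff_neq_zero)
  \<comment> \<open>Since \<open>0 < m\<close>, multiples of \<open>m\<close> exist beyond any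
    threshold.\<close>
  then obtain n where "0 < emeasure M ((T ^^ n) -` A \<inter> space M \<inter> (space M - A))" "m dvd n"
    unfolding eventually_sequentially
    by (metis dvd_triv_right m mult.commute nat_mult_le_cancel1 mult_1 One_nat_def Suc_leI mult_le_mono1)
  moreover have "(T ^^ (m * q)) -` A \<inter> space M = A" for q
  proof (induction q)
    case 0
    then show ?case using A sets.sets_into_space by auto
  next
    case (Suc q)
    have "(T ^^ (m * Suc q)) -` A \<inter> space M = (T ^^ m) -` ((T ^^ (m * q)) -` A \<inter> space M) \<inter> space M"
      using measurable_space[OF measurable_funpow[OF T]]
      by (auto simp: funpow_add add.commute[of m])
    then show ?case using Suc inv by simp
  qed
  ultimately show False by (auto simp: dvd_def)
qed

text \<open>Preimages under \<open>T\<close> exchange the two slices of an invariant set, so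
  \<open>T ^^ 2\<close> fixes each. Ergodicity of \<open>T ^^ 2\<close> makes the slice at 1 null or
  conull, and measure preservation carries this over to the slice at 2.\<close>

lemma ergodic_two_point:
  assumes lm: "lightly_mixing M T" and mp: "measure_preserving_map M T"
  shows "ergodic (M \<Otimes>\<^sub>M two_point_space c) (map_prod T two_point_rotation)"
  unfolding ergodic_def
proof (intro ballI impI)
  let ?P = "M \<Otimes>\<^sub>M two_point_space c" and ?T = "map_prod T two_point_rotation"
  fix W assume W: "W \<in> sets ?P" and inv: "?T -` W \<inter> space ?P = W"
  have T: "T \<in> M \<rightarrow>\<^sub>M M" and distr: "distr M M T = M"
    using mp by (auto simp: measure_preserving_map_def)
  have pres: "emeasure M (T -` C \<inter> space M) = emeasure M C" if "C \<in> sets M" for C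
    using emeasure_distr[OF T that] distr by simp
  have sl: "slice W i \<in> sets M" for i using W by (rule sets_Pair2)
  have step: "T -` slice W (two_point_rotation i) \<inter> space M = slice W i" if "i \<in> {1, 2}" for i
  proof -
    have "slice W i = slice (?T -` W \<inter> space ?P) i" using inv by simp
    also have "\<dots> = T -` slice W (two_point_rotation i) \<inter> space M"
      using that by (auto simp: space_pair_measure space_two_point_space)
    finally show ?thesis by simp
  qed
  have 1: "T -` slice W 2 \<inter> space M = slice W 1" and 2: "T -` slice W 1 \<inter> space M = slice W 2"
    using step[of 1] step[of 2] by (auto simp: two_point_rotation_def)
  have "(T ^^ 2) -` slice W 1 \<inter> space M = T -` (T -` slice W 1 \<inter> space M) \<inter> space M"
    using measurable_space[OF T] by (auto simp: numeral_2_eq_2)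
  also have "\<dots> = slice W 1" by (simp only: 1 2)
  finally have "emeasure M (slice W 1) = 0 \<or> emeasure M (space M - slice W 1) = 0"
    using ergodic_funpow_if_lightly_mixing[OF lm T, of 2] sl unfolding ergodic_def by simp
  then show "emeasure ?P W = 0 \<or> emeasure ?P (space ?P - W) = 0"
  proof
    assume 0: "emeasure M (slice W 1) = 0"
    then have "emeasure M (slice W 2) = 0" using pres[OF sl, of 1] 2 by simp
    then show ?thesis using 0 W by (auto intro!: emeasure_pair_two_point_eq_0)
  next
    assume 0: "emeasure M (space M - slice W 1) = 0"
    \<comment> \<open>Preimages commute with complements, so the complements of the slices are
      exchanged as well.\<close>
    have "T -` (space M - slice W 1) \<inter> space M = space M - slice W 2"
      using 2 measurable_space[OF T] by blast
    then have "emeasure M (space M - slice W 2) = 0"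
      using pres[of "space M - slice W 1"] sl 0 by (metis sets.compl_sets)
    moreover have "slice (space ?P - W) i = space M - slice W i" if "i \<in> {1, 2}" for i
      using that by (auto simp: space_pair_measure space_two_point_space)
    ultimately show ?thesis using 0 W
      by (intro disjI2 emeasure_pair_two_point_eq_0) auto
  qed
qed

lemma Linfty_eigenvalue_two_point:
  "Linfty_eigenvalue (M \<Otimes>\<^sub>M two_point_space c) (map_prod T two_point_rotation) (- 1)"
  unfolding Linfty_eigenvalue_def
proof (intro exI conjI AE_I2)
  let ?f = "(\<lambda>p. if snd p = 1 then 1 else - 1) :: 'a \<times> nat \<Rightarrow> complex"
  have "(\<lambda>i. if i = 1 then 1 else - 1 :: complex) \<in> borel_measurable (two_point_space c)"
    by (simp add: two_point_space_def)
  then show "?f \<in> borel_measurable (M \<Otimes>\<^sub>M two_point_space c)"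
    by (rule measurable_compose[OF measurable_snd])
  show "norm (?f x) \<le> 1" for x by simp
  show "?f x \<noteq> 0" for x by simp
  show "?f (map_prod T two_point_rotation x) = - 1 * ?f x"
    if "x \<in> space (M \<Otimes>\<^sub>M two_point_space c)" for x
    using that by (auto simp: space_pair_measure space_two_point_space two_point_rotation_def)
qed

theorem lemma2p3:
  fixes M :: "'a measure" and T1 :: "'a \<Rightarrow> 'a" and c :: real
  assumes "nonatomic_lebesgue_space M"
    and "finite_measure M"
    and "0 < emeasure M (space M)"
    and "measure_preserving_map M T1"
    and "lightly_mixing M T1"
    and "0 < c"
  shows "measurably_sensitive TYPE('b)
           (M \<Otimes>\<^sub>M two_point_space c) (map_prod T1 two_point_rotation) \<and>
         ergodic (M \<Otimes>\<^sub>M two_point_space c) (map_prod T1 two_point_rotation) \<and>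
         \<not> weakly_mixing (M \<Otimes>\<^sub>M two_point_space c) (map_prod T1 two_point_rotation)"
proof (intro conjI)
  let ?P = "M \<Otimes>\<^sub>M two_point_space c"
  have T: "T1 \<in> M \<rightarrow>\<^sub>M M" using assms(4) by (simp add: measure_preserving_map_def)
  show "measurably_sensitive TYPE('b) ?P (map_prod T1 two_point_rotation)"
  proof (rule measurably_sensitive_if_eventually_visits)
    show "eventually_visits ?P (map_prod T1 two_point_rotation) {1, 2} (\<lambda>i. space M \<times> {i})"
      by (rule eventually_visits_two_point[OF assms(5) T assms(6)])
    show "finite_measure ?P"
      using finite_measure_pair_measure[OF finite_measure_two_point_space assms(2)] .
    show "space M \<times> {i} \<in> sets ?P" if "i \<in> {1, 2}" for i
      using that by (intro pair_measureI) (auto simp: sets_two_point_space)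
    show "0 < emeasure ?P (space M \<times> {i})" if "i \<in> {1, 2}" for i
      using that assms(3,6)
      by (simp only: emeasure_pair_two_point[OF sets.top] ennreal_zero_less_mult_iff) simp
    \<comment> \<open>Each slice of \<open>Z\<close> has at most one point and is therefore null in
      \<open>M\<close>.\<close>
    fix Z assume Z: "Z \<in> sets ?P" and one: "\<And>x y. x \<in> Z \<Longrightarrow> y \<in> Z \<Longrightarrow> x = y"
    have "emeasure M (slice Z i) = 0" for i
    proof (cases "slice Z i = {}")
      case False
      then obtain a where "slice Z i = {a}" using one by blast
      then show ?thesis
        using nonatomic_lebesgue_space_singleton[OF assms(1)] sets_Pair2[OF Z] by metis
    qed simp
    then show "emeasure ?P Z = 0" using Z by (rule emeasure_pair_two_point_eq_0[rotated])
  qed simp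
  show "ergodic ?P (map_prod T1 two_point_rotation)"
    by (rule ergodic_two_point[OF assms(5,4)])
  \<comment> \<open>Weak mixing would leave 1 as the only eigenvalue.\<close>
  have "- 1 \<noteq> (1 :: complex)" by simp
  then show "\<not> weakly_mixing ?P (map_prod T1 two_point_rotation)"
    unfolding weakly_mixing_def using Linfty_eigenvalue_two_point by blast
qed

end
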